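(* Let $X\subset\mathcal M^B$ be bounded. There exist $\Delta_s>0$ and $r>0$, independent of $x\in X$, such that for every $x\in X$ there is a unique continuous map $\delta_x:V_x^B(\Delta_s)\to S_r$ such that $$F_x(v,\delta_x(v))=B R_x\bigl(v-P_xB^*\delta_x(v)\bigr)=c\qquad\text{for all }v\in V_x^B(\Delta_s),$$ and $\delta_x(0)=0$. Here $V_x^B(\rho):=\{v\in T_x\mathcal M^B:\|v\|_{\mathcal E}<\rho\}$, $S_r:=\{\delta\in\mathcal Y:\|\delta\|_{\mathcal Y}\le r\}$ and $F_x:T_x\mathcal M^B\times\mathcal Y\to\mathcal Y$, $F_x(v,\delta):=BR_x(v-P_xB^*\delta)$.
   Context: $\mathcal E,\mathcal Y$ are real Hilbert spaces. $\mathcal M\subset\mathcal E$ is a $C^2$ embedded submanifold; for $x\in\mathcal M$ the tangent space $T_x\mathcal M$ is identified with a closed linear subspace of $\mathcal E$ with the ambient norm. $B:\mathcal E\to\mathcal Y$ is a surjective bounded linear operator with adjoint $B^*$, $c\in\mathcal Y$, and $\mathcal M^B:=\{x\in\mathcal M: Bx=c\}$ is nonempty. For each $x\in\mathcal M$ a bounded linear projection $P_x:\mathcal E\to T_x\mathcal M$ onto $T_x\mathcal M$ is given (not necessarily orthogonal), and $L_x:=BP_xB^*:\mathcal Y\to\mathcal Y$. For each $x\in\mathcal M$ a $C^2$ map $R_x:T_x\mathcal M\to\mathcal M$ is given with $R_x(0)=x$, $DR_x(0)=\mathrm{Id}_{T_x\mathcal M}$. Standing assumptions: (A1) for every bounded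 $S\subset\mathcal M^B$ there is $C_S>0$ with $(L_x\delta,\delta)_{\mathcal Y}\ge C_S\|\delta\|_{\mathcal Y}^2$ for all $x\in S$, $\delta\in\mathcal Y$; (A2) the map $\mathcal M\to\mathcal L(\mathcal E,\mathcal E)$, $x\mapsto P_x$, is continuous and maps bounded sets to bounded sets; (A3) for every bounded $S\subset\mathcal M$ there are $\sigma,K_1,K_2>0$ such that $\|DR_x(u)\|\le K_1$ and $\|D^2R_x(u)\|\le K_2$ for all $x\in S$ and $u\in T_x\mathcal M$ with $\|u\|_{\mathcal E}\le\sigma$ (operator norms, $R_x$ viewed as a map into $\mathcal E$). Under (A1), $L_x$ is invertible and $\mathcal M^B$ is a $C^2$ Hilbert submanifold with $T_x\mathcal M^B=T_x\mathcal M\cap\ker B$. *)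

theory Defs
  imports "HOL-Analysis.Analysis"
begin

text \<open>
  A twice continuously differentiable map on a set \<open>S\<close> together with its first and second
  derivatives.  It is used for open sets \<open>S\<close>, where this is the usual notion, and for closed
  linear subspaces \<open>S\<close> of a Hilbert space.  In the latter case \<open>f\<close> is regarded as a map on
  the Hilbert space \<open>S\<close>; the true derivatives are the restrictions of \<open>D u\<close> and \<open>D2 u\<close>
  to arguments in \<open>S\<close>, and these are uniquely determined.  Values of \<open>D u\<close> and \<open>D2 u\<close>
  outside \<open>S\<close> have no meaning (composing with the orthogonal projection onto \<open>S\<close> shows
  that extensions to the ambient space always exist).
\<close>

definition C2_derivs_on ::
  "'a::real_normed_vector set \<Rightarrow> ('a \<Rightarrow> 'b::real_normed_vector) \<Rightarrow>
   ('a \<Rightarrow> 'a \<Rightarrow>\<^sub>L 'b) \<Rightarrow> ('a \<Rightarrow> 'a \<Rightarrow>\<^sub>L 'a \<Rightarrow>\<^sub>L 'b) \<Rightarrow> bool" where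
  "C2_derivs_on S f D D2 \<longleftrightarrow>
     (\<forall>u\<in>S. (f has_derivative blinfun_apply (D u)) (at u within S)) \<and>
     (\<forall>u\<in>S. (D has_derivative blinfun_apply (D2 u)) (at u within S)) \<and>
     continuous_on S D2"

definition C2_on :: "'a::real_normed_vector set \<Rightarrow> ('a \<Rightarrow> 'b::real_normed_vector) \<Rightarrow> bool" where
  "C2_on S f \<longleftrightarrow> (\<exists>D D2. C2_derivs_on S f D D2)"

text \<open>
  Embedded submanifolds are described by local \<open>C\<^sup>2\<close> diffeomorphisms of the ambient space that
  straighten the set to a closed linear subspace.
\<close>

definition C2_embedded_submanifold :: "'a::{real_inner,complete_space} set \<Rightarrow> bool" where
  "C2_embedded_submanifold M \<longleftrightarrow>
     (\<forall>x\<in>M. \<exists>U V \<phi> \<psi> H.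
        open U \<and> x \<in> U \<and> open V \<and> homeomorphism U V \<phi> \<psi> \<and> C2_on U \<phi> \<and> C2_on V \<psi> \<and>
        subspace H \<and> closed (H :: 'a set) \<and> \<phi> ` (U \<inter> M) = V \<inter> H)"

text \<open>Tangent vectors are the velocities of \<open>C\<^sup>1\<close> curves in the set.\<close>

definition tangent_space :: "'a::real_normed_vector set \<Rightarrow> 'a \<Rightarrow> 'a set" where
  "tangent_space M x =
     {v. \<exists>\<gamma> \<epsilon>. 0 < \<epsilon> \<and> \<gamma> C1_differentiable_on {-\<epsilon><..<\<epsilon>} \<and> \<gamma> ` {-\<epsilon><..<\<epsilon>} \<subseteq> M \<and>
          \<gamma> 0 = x \<and> (\<gamma> has_vector_derivative v) (at (0::real))}"

definition constraint_set ::
  "'e::real_normed_vector set \<Rightarrow> ('e \<Rightarrow>\<^sub>L 'y::real_normed_vector) \<Rightarrow> 'y \<Rightarrow> 'e set" where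
  "constraint_set M B c = {x\<in>M. blinfun_apply B x = c}"

text \<open>
  For a bounded linear map between Hilbert spaces, \<^const>\<open>adjoint\<close> is the Hilbert space
  adjoint, which exists by the Riesz representation theorem.
\<close>

definition L_op ::
  "('e::{real_inner,complete_space} \<Rightarrow>\<^sub>L 'y::{real_inner,complete_space}) \<Rightarrow>
   ('e \<Rightarrow> 'e \<Rightarrow>\<^sub>L 'e) \<Rightarrow> 'e \<Rightarrow> 'y \<Rightarrow> 'y" where
  "L_op B P x \<delta> = blinfun_apply B (blinfun_apply (P x) (adjoint (blinfun_apply B) \<delta>))"

definition F_map ::
  "('e::{real_inner,complete_space} \<Rightarrow>\<^sub>L 'y::{real_inner,complete_space}) \<Rightarrow>
   ('e \<Rightarrow> 'e \<Rightarrow>\<^sub>L 'e) \<Rightarrow> ('e \<Rightarrow> 'e \<Rightarrow> 'e) \<Rightarrow> 'e \<Rightarrow> 'e \<Rightarrow> 'y \<Rightarrow> 'y" where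
  "F_map B P R x v \<delta> =
     blinfun_apply B (R x (v - blinfun_apply (P x) (adjoint (blinfun_apply B) \<delta>)))"

definition tangent_ball :: "'a::real_normed_vector set \<Rightarrow> 'a \<Rightarrow> real \<Rightarrow> 'a set" where
  "tangent_ball N x \<rho> = {v \<in> tangent_space N x. norm v < \<rho>}"

definition implicit_solution ::
  "'e::{real_inner,complete_space} set \<Rightarrow> ('e \<Rightarrow>\<^sub>L 'y::{real_inner,complete_space}) \<Rightarrow> 'y \<Rightarrow>
   ('e \<Rightarrow> 'e \<Rightarrow>\<^sub>L 'e) \<Rightarrow> ('e \<Rightarrow> 'e \<Rightarrow> 'e) \<Rightarrow> 'e \<Rightarrow> real \<Rightarrow> real \<Rightarrow> ('e \<Rightarrow> 'y) \<Rightarrow> bool" where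
  "implicit_solution M B c P R x \<rho> r \<delta> \<longleftrightarrow>
     continuous_on (tangent_ball (constraint_set M B c) x \<rho>) \<delta> \<and>
     \<delta> ` tangent_ball (constraint_set M B c) x \<rho> \<subseteq> cball 0 r \<and>
     (\<forall>v \<in> tangent_ball (constraint_set M B c) x \<rho>. F_map B P R x v (\<delta> v) = c)"

end

theory Submission
  imports Defs
begin

text \<open>
  Fix \<open>x \<in> X\<close> and write \<open>T\<close> for the tangent space of \<open>M\<close> at \<open>x\<close> and \<open>A\<close> for the adjoint of \<open>B\<close>.
  Since \<open>R x\<close> agrees with \<open>u \<mapsto> x + u\<close> to first order at \<open>0\<close>, the map
  \<open>\<delta> \<mapsto> c - F x v \<delta>\<close> is, up to the error \<open>E u = R x u - u\<close>, the linear operator \<open>L\<^sub>x\<close>, which is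
  coercive with a constant \<open>C\<close> that does not depend on \<open>x\<close>.  The bound \<open>K\<close> on the second derivative
  of \<open>R x\<close> makes \<open>E\<close> Lipschitz with constant \<open>K * \<rho>\<close> on the ball of radius \<open>\<rho>\<close> in \<open>T\<close>
  (\<open>retraction_error_lipschitz\<close>).  For small \<open>\<rho>\<close> this error costs at most half of the coercivity, so
  \<open>\<delta> \<mapsto> c - F x v \<delta>\<close> is strongly monotone with modulus \<open>C / 2\<close> and Lipschitz on a ball \<open>S\<^sub>r\<close>.
  Moreover its value at \<open>\<delta> = 0\<close> is small when \<open>v\<close> is a small element of the kernel of \<open>B\<close>.

  A strongly monotone Lipschitz map with a small value at the centre of a ball has exactly one
  zero in that ball, because a short step against the map is a contraction; and strong
  monotonicity turns continuity of the map in a parameter into continuity of the zero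
  (\<open>strongly_monotone_zero\<close>, \<open>strongly_monotone_implicit_function\<close>).  Compared with inverting
  \<open>L\<^sub>x\<close> and applying the implicit function theorem at each \<open>x\<close>, this keeps every
  constant explicit in \<open>C\<close>, \<open>K\<close> and bounds for \<open>B\<close> and \<open>P x\<close>, which is the required uniformity.

  The parameters \<open>v\<close> are tangent to the constraint set and hence lie in \<open>T\<close> and in the kernel of
  \<open>B\<close>: differentiate \<open>B (\<gamma> t) = c\<close> along curves \<open>\<gamma>\<close>.  The bounds for \<open>A\<close> rest on its existence, which
  is the Riesz representation theorem (\<open>riesz_representation\<close>).
\<close>

section \<open>Adjoints in Hilbert spaces\<close>

text \<open>
  The representing vector is the minimiser of \<open>J x = \<parallel>x\<parallel>\<^sup>2 - 2 \<phi> x\<close>.  The parallelogram law makes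
  minimising sequences Cauchy, and the first-order condition at the minimiser is the claim.
\<close>

lemma riesz_representation:
  fixes \<phi> :: "'a::{real_inner,complete_space} \<Rightarrow> real"
  assumes "bounded_linear \<phi>"
  obtains z where "\<And>h. \<phi> h = h \<bullet> z"
proof -
  interpret \<phi>: bounded_linear \<phi> by (rule assms)
  define J where "J x = (norm x)\<^sup>2 - 2 * \<phi> x" for x
  obtain K where K: "\<And>x. norm (\<phi> x) \<le> norm x * K"
    using \<phi>.bounded by blast
  have lower: "- K\<^sup>2 \<le> J x" for x
  proof -
    have "\<phi> x \<le> norm x * K"
      using K[of x] by simp
    moreover have "0 \<le> (norm x - K)\<^sup>2"
      by simp
    ultimately show ?thesis
      unfolding J_def by (simp add: power2_diff)
  qed
  define d where "d = (INF x. J x)"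
  have bdd: "bdd_below (range J)"
    using lower by (meson bdd_belowI2)
  have d_le: "d \<le> J x" for x
    unfolding d_def by (rule cINF_lower[OF bdd]) simp
  have "\<exists>x. J x < d + 1 / real (Suc n)" for n
  proof -
    have "(INF x. J x) < d + 1 / real (Suc n)"
      unfolding d_def by simp
    then show ?thesis
      using cINF_less_iff[OF _ bdd] by auto
  qed
  then obtain s where s: "\<And>n. J (s n) < d + 1 / real (Suc n)"
    by metis
  have par: "(norm (x - y))\<^sup>2 \<le> 2 * (J x - d) + 2 * (J y - d)" for x y
  proof -
    define w where "w = (1/2) *\<^sub>R (x + y)"
    have "(norm (x - y))\<^sup>2 = 2 * J x + 2 * J y - 4 * J w"
      unfolding w_def J_def power2_norm_eq_inner \<phi>.scaleR \<phi>.add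
      by (simp add: inner_simps inner_commute field_simps)
    moreover have "d \<le> J w"
      by (rule d_le)
    ultimately show ?thesis
      by (simp add: algebra_simps)
  qed
  have "Cauchy s"
  proof (rule CauchyI)
    fix e :: real
    assume "0 < e"
    then obtain N where N: "1 / real (Suc N) < e\<^sup>2 / 4"
      by (metis nat_approx_posE zero_less_divide_iff zero_less_numeral zero_less_power)
    have close: "J (s n) - d < e\<^sup>2 / 4" if "N \<le> n" for n
    proof -
      have "1 / real (Suc n) \<le> 1 / real (Suc N)"
        using that by (simp add: frac_le)
      with s[of n] N show ?thesis
        by linarith
    qed
    have "norm (s m - s n) < e" if "N \<le> m" "N \<le> n" for m n
    proof -
      have "(norm (s m - s n))\<^sup>2 < e\<^sup>2"
        using par[of "s m" "s n"] close[OF that(1)] close[OF that(2)]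
        by (simp add: field_simps)
      then show ?thesis
        using \<open>0 < e\<close> by (simp add: power_less_imp_less_base)
    qed
    then show "\<exists>N. \<forall>m\<ge>N. \<forall>n\<ge>N. norm (s m - s n) < e"
      by blast
  qed
  then obtain z where z: "s \<longlonglongrightarrow> z"
    using Cauchy_convergent_iff convergent_def by blast
  have "(\<lambda>n. J (s n)) \<longlonglongrightarrow> J z"
    unfolding J_def by (intro tendsto_intros z \<phi>.tendsto)
  moreover have "(\<lambda>n. d + 1 / real (Suc n)) \<longlonglongrightarrow> d + 0"
    by (intro tendsto_intros LIMSEQ_Suc[OF lim_1_over_n])
  ultimately have "J z \<le> d + 0"
  proof (rule LIMSEQ_le)
    show "\<exists>N. \<forall>n\<ge>N. J (s n) \<le> d + 1 / real (Suc n)"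
      using s less_imp_le by blast
  qed
  then have min: "J z \<le> J y" for y
    using d_le[of y] by simp
  have "\<phi> h = h \<bullet> z" for h
  proof (cases "h = 0")
    case False
    define e where "e = h \<bullet> z - \<phi> h"
    define t where "t = - e / (h \<bullet> h)"
    have "J (z + t *\<^sub>R h) = J z + t\<^sup>2 * (h \<bullet> h) + 2 * t * e"
      unfolding J_def e_def power2_norm_eq_inner \<phi>.scaleR \<phi>.add inner_add_left inner_add_right
        inner_scaleR_left inner_scaleR_right inner_commute[of z h]
      by (simp add: algebra_simps power2_eq_square)
    moreover have "t\<^sup>2 * (h \<bullet> h) + 2 * t * e = - (e\<^sup>2 / (h \<bullet> h))"
      using False unfolding t_def by (simp add: field_simps power2_eq_square)
    ultimately have "e\<^sup>2 / (h \<bullet> h) \<le> 0"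
      using min[of "z + t *\<^sub>R h"] by simp
    moreover have "0 < h \<bullet> h"
      using False by simp
    ultimately have "e\<^sup>2 \<le> 0"
      by (simp add: divide_le_0_iff not_less)
    then have "e = 0"
      by simp
    then show ?thesis
      by (simp add: e_def)
  qed simp
  with that show ?thesis
    by blast
qed

text \<open>
  The constant \<^const>\<open>adjoint\<close> is a choice operator, so its defining property holds only once some
  adjoint is known to exist; Riesz representation of \<open>\<lambda>h. B h \<bullet> y\<close> supplies one.
\<close>

lemma inner_adjoint_hilbert:
  fixes B :: "'a::{real_inner,complete_space} \<Rightarrow>\<^sub>L 'b::real_inner"
  shows "h \<bullet> adjoint (blinfun_apply B) y = blinfun_apply B h \<bullet> y"
proof -
  have "\<exists>z. \<forall>h. blinfun_apply B h \<bullet> y = h \<bullet> z" for y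
  proof -
    have "bounded_linear (\<lambda>h. blinfun_apply B h \<bullet> y)"
      by (intro bounded_linear_intros)
    then show ?thesis
      by (rule riesz_representation) blast
  qed
  then have "\<exists>f'. \<forall>h y. blinfun_apply B h \<bullet> y = h \<bullet> f' y"
    by metis
  then have "\<forall>h y. blinfun_apply B h \<bullet> y = h \<bullet> adjoint (blinfun_apply B) y"
    unfolding adjoint_def by (rule someI_ex)
  then have "blinfun_apply B h \<bullet> y = h \<bullet> adjoint (blinfun_apply B) y"
    by (elim allE)
  then show ?thesis
    by (rule sym)
qed

lemma adjoint_diff_hilbert:
  fixes B :: "'a::{real_inner,complete_space} \<Rightarrow>\<^sub>L 'b::real_inner"
  shows "adjoint (blinfun_apply B) (y - z) =
           adjoint (blinfun_apply B) y - adjoint (blinfun_apply B) z"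
proof -
  have "\<forall>h. h \<bullet> adjoint (blinfun_apply B) (y - z) =
          h \<bullet> (adjoint (blinfun_apply B) y - adjoint (blinfun_apply B) z)"
    by (simp add: inner_adjoint_hilbert inner_diff_right)
  then show ?thesis
    unfolding vector_eq_ldot .
qed

lemma norm_adjoint_hilbert_le:
  fixes B :: "'a::{real_inner,complete_space} \<Rightarrow>\<^sub>L 'b::real_inner"
  shows "norm (adjoint (blinfun_apply B) y) \<le> norm B * norm y"
proof -
  define a where "a = adjoint (blinfun_apply B) y"
  have "norm a * norm a = a \<bullet> a"
    by (simp only: dot_square_norm power2_eq_square)
  also have "\<dots> = blinfun_apply B a \<bullet> y"
    unfolding a_def by (rule inner_adjoint_hilbert)
  also have "\<dots> \<le> norm (blinfun_apply B a) * norm y"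
    by (rule norm_cauchy_schwarz)
  also have "\<dots> \<le> (norm B * norm a) * norm y"
    by (intro mult_right_mono norm_blinfun norm_ge_zero)
  finally have sq: "norm a * norm a \<le> norm B * norm y * norm a"
    by (simp only: mult_ac)
  show ?thesis
  proof (cases "a = 0")
    case True
    then show ?thesis
      by (simp flip: a_def)
  next
    case False
    with sq have "norm a \<le> norm B * norm y"
      by simp
    then show ?thesis
      by (simp only: a_def)
  qed
qed

section \<open>Zeros of strongly monotone maps\<close>

text \<open>
  A local form of Zarantonello's theorem.  The zeros of \<open>G\<close> are the fixed points of
  \<open>a \<mapsto> a - t *\<^sub>R G a\<close>; expanding the square of the norm bounds the Lipschitz constant of this map by
  the square root of \<open>1 - 2 * t * m + t\<^sup>2 * \<Lambda>\<^sup>2\<close>.  The step \<open>t = m / \<Lambda>\<^sup>2\<close> minimises that quantity,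
  and the bound on \<open>G 0\<close> is what keeps the ball invariant under the map.
\<close>

lemma strongly_monotone_zero:
  fixes G :: "'y::{real_inner,complete_space} \<Rightarrow> 'y"
  assumes m: "0 < m" and r: "0 \<le> r"
    and mono: "\<And>a b. a \<in> cball 0 r \<Longrightarrow> b \<in> cball 0 r \<Longrightarrow>
                 m * (norm (a - b))\<^sup>2 \<le> (G a - G b) \<bullet> (a - b)"
    and lip: "\<And>a b. a \<in> cball 0 r \<Longrightarrow> b \<in> cball 0 r \<Longrightarrow> norm (G a - G b) \<le> \<Lambda> * norm (a - b)"
    and small: "norm (G 0) \<le> m * r / 2"
  shows "\<exists>!a. a \<in> cball 0 r \<and> G a = 0"
proof -
  \<comment> \<open>Enlarging the Lipschitz constant makes \<open>1 - m\<^sup>2 / N\<^sup>2\<close> nonnegative, also when the ball is a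
      single point and any \<open>\<Lambda>\<close> is a Lipschitz constant.\<close>
  define N where "N = max \<Lambda> m"
  have N: "0 < N" "m \<le> N"
    using m by (auto simp: N_def)
  define t where "t = m / N\<^sup>2"
  have t: "0 < t"
    using m N by (simp add: t_def)
  define q where "q = sqrt (1 - m\<^sup>2 / N\<^sup>2)"
  have frac: "0 < m\<^sup>2 / N\<^sup>2" "m\<^sup>2 / N\<^sup>2 \<le> 1"
    using m N by (auto simp: power_mono)
  have q: "0 \<le> q" "q < 1" "q\<^sup>2 = 1 - m\<^sup>2 / N\<^sup>2"
    using frac by (auto simp: q_def)
  define T where "T a = a - t *\<^sub>R G a" for a
  have contract: "norm (T a - T b) \<le> q * norm (a - b)"
    if ab: "a \<in> cball 0 r" "b \<in> cball 0 r" for a b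
  proof -
    let ?g = "G a - G b"
    have "norm ?g \<le> N * norm (a - b)"
      using lip[OF ab] mult_right_mono[of \<Lambda> N "norm (a - b)"] by (simp add: N_def)
    then have "(norm ?g)\<^sup>2 \<le> N\<^sup>2 * (norm (a - b))\<^sup>2"
      by (metis norm_ge_zero power_mono power_mult_distrib)
    then have sq: "t\<^sup>2 * (norm ?g)\<^sup>2 \<le> t\<^sup>2 * (N\<^sup>2 * (norm (a - b))\<^sup>2)"
      by (intro mult_left_mono) auto
    have in1: "2 * t * (m * (norm (a - b))\<^sup>2) \<le> 2 * t * (?g \<bullet> (a - b))"
      using mono[OF ab] t by (intro mult_left_mono) auto
    have "T a - T b = (a - b) - t *\<^sub>R ?g"
      by (simp add: T_def algebra_simps)
    then have "(norm (T a - T b))\<^sup>2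
        = (norm (a - b))\<^sup>2 - 2 * t * (?g \<bullet> (a - b)) + t\<^sup>2 * (norm ?g)\<^sup>2"
      by (simp only: power2_norm_eq_inner inner_diff_left inner_diff_right inner_scaleR_left
          inner_scaleR_right) (simp add: inner_commute algebra_simps power2_eq_square)
    also have "\<dots> \<le> (1 - 2 * t * m + t\<^sup>2 * N\<^sup>2) * (norm (a - b))\<^sup>2"
      using sq in1 by (simp add: algebra_simps)
    also have "1 - 2 * t * m + t\<^sup>2 * N\<^sup>2 = q\<^sup>2"
      using N unfolding q(3) t_def by (simp add: field_simps power2_eq_square)
    finally have "(norm (T a - T b))\<^sup>2 \<le> (q * norm (a - b))\<^sup>2"
      unfolding power_mult_distrib .
    then show ?thesis
      by (rule power2_le_imp_le) (use q in simp)
  qed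
  have zero: "(0::'y) \<in> cball 0 r"
    using r by simp
  have invariant: "T ` cball 0 r \<subseteq> cball 0 r"
  proof clarsimp
    fix a :: 'y
    assume a: "norm a \<le> r"
    have "t * norm (G 0) \<le> t * (m * r / 2)"
      using small t by simp
    also have "\<dots> = r * (1 - q\<^sup>2) / 2"
      using N unfolding q(3) t_def by (simp add: field_simps power2_eq_square)
    also have "\<dots> = r * (1 - q) - r * (1 - q)\<^sup>2 / 2"
      by (simp add: power2_eq_square field_simps)
    also have "\<dots> \<le> r * (1 - q)"
      using r by simp
    finally have T0: "norm (T 0) \<le> r * (1 - q)"
      using t by (simp add: T_def)
    have "norm (T a) \<le> norm (T a - T 0) + norm (T 0)"
      by (metis diff_add_cancel norm_triangle_ineq)
    moreover have "norm (T a - T 0) \<le> q * norm a"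
      using contract[OF _ zero, of a] a by simp
    moreover have "q * norm a \<le> q * r"
      using a q by (simp add: mult_left_mono)
    ultimately show "norm (T a) \<le> r"
      using T0 by (simp add: algebra_simps)
  qed
  have "\<exists>!a. a \<in> cball 0 r \<and> T a = a"
    using Banach_fix[of "cball 0 r" q T] q invariant contract zero
    by (auto simp: dist_norm complete_eq_closed)
  moreover have "T a = a \<longleftrightarrow> G a = 0" for a
    using t by (simp add: T_def)
  ultimately show ?thesis
    by simp
qed

text \<open>
  Continuity of the zero needs continuity of \<open>G\<close> in the parameter only for each fixed second
  argument: strong monotonicity of \<open>G v\<close> bounds the distance of \<open>\<delta> v\<close> and \<open>\<delta> w\<close> by
  \<open>norm (G v (\<delta> w)) / m\<close>, and \<open>G v (\<delta> w)\<close> tends to \<open>G w (\<delta> w) = 0\<close> as \<open>v\<close> tends to \<open>w\<close>.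
\<close>

lemma strongly_monotone_implicit_function:
  fixes G :: "'v::topological_space \<Rightarrow> 'y::{real_inner,complete_space} \<Rightarrow> 'y"
  assumes m: "0 < m" and r: "0 \<le> r"
    and mono: "\<And>v a b. v \<in> V \<Longrightarrow> a \<in> cball 0 r \<Longrightarrow> b \<in> cball 0 r \<Longrightarrow>
                 m * (norm (a - b))\<^sup>2 \<le> (G v a - G v b) \<bullet> (a - b)"
    and lip: "\<And>v a b. v \<in> V \<Longrightarrow> a \<in> cball 0 r \<Longrightarrow> b \<in> cball 0 r \<Longrightarrow>
                 norm (G v a - G v b) \<le> \<Lambda> * norm (a - b)"
    and small: "\<And>v. v \<in> V \<Longrightarrow> norm (G v 0) \<le> m * r / 2"
    and cont: "\<And>a. a \<in> cball 0 r \<Longrightarrow> continuous_on V (\<lambda>v. G v a)"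
  shows "\<exists>\<delta>. continuous_on V \<delta> \<and> (\<forall>v\<in>V. \<delta> v \<in> cball 0 r \<and> G v (\<delta> v) = 0 \<and>
           (\<forall>a\<in>cball 0 r. G v a = 0 \<longrightarrow> a = \<delta> v))"
proof -
  have ex1: "\<exists>!a. a \<in> cball 0 r \<and> G v a = 0" if "v \<in> V" for v
    by (rule strongly_monotone_zero[OF m r mono[OF that] lip[OF that] small[OF that]])
  define \<delta> where "\<delta> v = (THE a. a \<in> cball 0 r \<and> G v a = 0)" for v
  have \<delta>: "\<delta> v \<in> cball 0 r" "G v (\<delta> v) = 0" if "v \<in> V" for v
    using theI'[OF ex1[OF that]] by (auto simp: \<delta>_def)
  have dist_le: "norm (\<delta> v - \<delta> w) \<le> norm (G v (\<delta> w)) / m" if vw: "v \<in> V" "w \<in> V" for v w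
  proof -
    have "m * (norm (\<delta> v - \<delta> w))\<^sup>2 \<le> (G v (\<delta> v) - G v (\<delta> w)) \<bullet> (\<delta> v - \<delta> w)"
      using mono vw \<delta> by blast
    also have "\<dots> \<le> norm (G v (\<delta> w)) * norm (\<delta> v - \<delta> w)"
      using norm_cauchy_schwarz[of "- G v (\<delta> w)" "\<delta> v - \<delta> w"] \<delta>(2)[OF vw(1)] by simp
    finally have "norm (\<delta> v - \<delta> w) * (m * norm (\<delta> v - \<delta> w)) \<le>
        norm (\<delta> v - \<delta> w) * norm (G v (\<delta> w))"
      by (simp add: power2_eq_square mult_ac)
    then have "m * norm (\<delta> v - \<delta> w) \<le> norm (G v (\<delta> w))"
      by (cases "\<delta> v = \<delta> w") auto
    then show ?thesis
      using m by (simp add: field_simps)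
  qed
  have "continuous_on V \<delta>"
    unfolding continuous_on_def
  proof
    fix w
    assume w: "w \<in> V"
    have "((\<lambda>v. G v (\<delta> w)) \<longlongrightarrow> G w (\<delta> w)) (at w within V)"
      using cont[OF \<delta>(1)[OF w]] w by (simp add: continuous_on_def)
    then have "((\<lambda>v. norm (G v (\<delta> w)) / m) \<longlongrightarrow> norm (G w (\<delta> w)) / m) (at w within V)"
      by (intro tendsto_intros) (use m in auto)
    then have "((\<lambda>v. norm (G v (\<delta> w)) / m) \<longlongrightarrow> 0) (at w within V)"
      by (simp add: \<delta>(2)[OF w])
    moreover have "\<forall>\<^sub>F v in at w within V. norm (\<delta> v - \<delta> w) \<le> norm (G v (\<delta> w)) / m"
      using dist_le[OF _ w] by (auto simp: eventually_at_filter)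
    ultimately have "((\<lambda>v. \<delta> v - \<delta> w) \<longlongrightarrow> 0) (at w within V)"
      by (rule Lim_null_comparison[rotated])
    then show "(\<delta> \<longlongrightarrow> \<delta> w) (at w within V)"
      by (simp add: LIM_zero_iff)
  qed
  moreover have "a = \<delta> v" if "v \<in> V" "a \<in> cball 0 r" "G v a = 0" for v a
    using ex1[OF that(1)] \<delta>[OF that(1)] that(2,3) by (metis (no_types))
  ultimately show ?thesis
    using \<delta> by blast
qed

section \<open>The error of a retraction against its linearisation\<close>

text \<open>
  The mean value inequality with the derivative bounded only in the direction of the increment.
  For maps on a subspace this is the usable form, because a derivative within the subspace is
  controlled only in its own directions.
\<close>

lemma norm_increment_le_directional:
  fixes f :: "'a::real_normed_vector \<Rightarrow> 'b::real_normed_vector"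
  assumes S: "convex S" "x \<in> S" "y \<in> S"
    and der: "\<And>z. z \<in> S \<Longrightarrow> (f has_derivative f' z) (at z within S)"
    and bound: "\<And>z. z \<in> S \<Longrightarrow> norm (f' z (y - x)) \<le> K"
  shows "norm (f y - f x) \<le> K"
proof -
  define \<gamma> where "\<gamma> t = x + t *\<^sub>R (y - x)" for t :: real
  have \<gamma>: "\<gamma> t \<in> S" if "t \<in> {0..1}" for t
  proof -
    have "\<gamma> t = (1 - t) *\<^sub>R x + t *\<^sub>R y"
      by (simp add: \<gamma>_def algebra_simps)
    then show ?thesis
      using S that by (simp add: convexD)
  qed
  have "norm (f (\<gamma> 1) - f (\<gamma> 0)) \<le> K * norm (1 - 0 :: real)"
  proof (rule differentiable_bound[of "{0..1}" "\<lambda>t. f (\<gamma> t)" "\<lambda>t s. f' (\<gamma> t) (s *\<^sub>R (y - x))"])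
    fix t :: real
    assume t: "t \<in> {0..1}"
    show "((\<lambda>t. f (\<gamma> t)) has_derivative (\<lambda>s. f' (\<gamma> t) (s *\<^sub>R (y - x)))) (at t within {0..1})"
    proof (rule has_derivative_in_compose2[where g = f and t = S])
      show "(\<gamma> has_derivative (\<lambda>s. s *\<^sub>R (y - x))) (at t within {0..1})"
        unfolding \<gamma>_def by (auto intro!: derivative_eq_intros)
    qed (use der \<gamma> t in auto)
    interpret D: bounded_linear "f' (\<gamma> t)"
      using der[OF \<gamma>[OF t]] by (rule has_derivative_bounded_linear)
    show "onorm (\<lambda>s. f' (\<gamma> t) (s *\<^sub>R (y - x))) \<le> K"
      using bound[OF \<gamma>[OF t]]
      by (intro onorm_le) (simp add: D.scaleR mult_left_mono mult.commute[of K])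
  qed auto
  then show ?thesis
    by (simp add: \<gamma>_def)
qed

text \<open>
  The mean value inequality is applied twice: once to the derivative, which is the identity at \<open>0\<close>
  and so differs from it by at most \<open>K * \<rho>\<close> on the ball of radius \<open>\<rho>\<close>, and once to \<open>f\<close> itself.
\<close>

lemma retraction_error_lipschitz:
  fixes f :: "'a::real_normed_vector \<Rightarrow> 'a"
  assumes T: "subspace T"
    and f: "C2_derivs_on T f D D2"
    and D0: "\<And>h. h \<in> T \<Longrightarrow> blinfun_apply (D 0) h = h"
    and K: "0 \<le> K"
    and D2: "\<And>u h k. u \<in> T \<Longrightarrow> norm u \<le> \<rho> \<Longrightarrow> h \<in> T \<Longrightarrow> k \<in> T \<Longrightarrow>
               norm (blinfun_apply (blinfun_apply (D2 u) h) k) \<le> K * norm h * norm k"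
    and u: "u \<in> T" "norm u \<le> \<rho>" and w: "w \<in> T" "norm w \<le> \<rho>"
  shows "norm ((f w - w) - (f u - u)) \<le> K * \<rho> * norm (w - u)"
proof -
  define S where "S = T \<inter> cball 0 \<rho>"
  have S: "convex S" "S \<subseteq> T"
    unfolding S_def by (auto intro: convex_Int subspace_imp_convex T)
  have derf: "(f has_derivative blinfun_apply (D z)) (at z within S)"
    and derD: "(D has_derivative blinfun_apply (D2 z)) (at z within S)" if "z \<in> S" for z
    using f that S(2) unfolding C2_derivs_on_def by (meson has_derivative_subset subsetD)+
  have rho: "0 \<le> \<rho>"
    using u(2) norm_ge_zero order_trans by blast
  then have S0: "0 \<in> S"
    using T by (simp add: S_def subspace_0)
  have D_near_id: "norm (blinfun_apply (D z) h - h) \<le> K * \<rho> * norm h"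
    if z: "z \<in> S" and h: "h \<in> T" for z h
  proof -
    have "norm (blinfun_apply (D z) h - blinfun_apply (D 0) h) \<le> K * \<rho> * norm h"
    proof (rule norm_increment_le_directional[OF S(1) S0 z,
          where f' = "\<lambda>y k. blinfun_apply (blinfun_apply (D2 y) k) h"])
      fix y
      assume y: "y \<in> S"
      show "((\<lambda>y. blinfun_apply (D y) h) has_derivative
          (\<lambda>k. blinfun_apply (blinfun_apply (D2 y) k) h)) (at y within S)"
        using derD[OF y] by (auto intro!: derivative_eq_intros)
      have "norm (blinfun_apply (blinfun_apply (D2 y) z) h) \<le> K * norm z * norm h"
        using D2 y z h by (auto simp: S_def)
      also have "\<dots> \<le> K * \<rho> * norm h"
        using z K by (intro mult_right_mono mult_left_mono) (auto simp: S_def)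
      finally show "norm (blinfun_apply (blinfun_apply (D2 y) (z - 0)) h) \<le> K * \<rho> * norm h"
        by simp
    qed
    then show ?thesis
      by (simp add: D0[OF h])
  qed
  show ?thesis
  proof (rule norm_increment_le_directional[OF S(1),
        where f = "\<lambda>z. f z - z" and f' = "\<lambda>z h. blinfun_apply (D z) h - h"])
    show "u \<in> S" "w \<in> S"
      using u w by (auto simp: S_def)
    fix z
    assume z: "z \<in> S"
    show "((\<lambda>z. f z - z) has_derivative (\<lambda>h. blinfun_apply (D z) h - h)) (at z within S)"
      using derf[OF z] by (auto intro!: derivative_eq_intros)
    show "norm (blinfun_apply (D z) (w - u) - (w - u)) \<le> K * \<rho> * norm (w - u)"
      using D_near_id[OF z] u w T by (simp add: subspace_diff)
  qed
qed

section \<open>Tangent vectors of the constraint set\<close>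

lemma tangent_space_constraint_set_subset:
  "tangent_space (constraint_set M B c) x \<subseteq> tangent_space M x \<inter> {v. blinfun_apply B v = 0}"
proof
  fix v
  assume "v \<in> tangent_space (constraint_set M B c) x"
  then obtain \<gamma> \<epsilon> where e: "0 < \<epsilon>" and C1: "\<gamma> C1_differentiable_on {-\<epsilon><..<\<epsilon>}"
    and sub: "\<gamma> ` {-\<epsilon><..<\<epsilon>} \<subseteq> constraint_set M B c" and at0: "\<gamma> 0 = x"
    and der: "(\<gamma> has_vector_derivative v) (at (0::real))"
    unfolding tangent_space_def by blast
  have const: "blinfun_apply B (\<gamma> t) = c" if "t \<in> {-\<epsilon><..<\<epsilon>}" for t
  proof -
    have "\<gamma> t \<in> constraint_set M B c"
      using sub that by blast
    then show ?thesis
      by (simp add: constraint_set_def)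
  qed
  have "((\<lambda>t. blinfun_apply B (\<gamma> t)) has_vector_derivative blinfun_apply B v) (at 0)"
    using blinfun.bounded_linear_right der by (rule bounded_linear.has_vector_derivative)
  moreover have "((\<lambda>t. blinfun_apply B (\<gamma> t)) has_vector_derivative 0) (at 0)"
    by (rule has_vector_derivative_transform_within_open[of "\<lambda>_. c" _ _ "{-\<epsilon><..<\<epsilon>}"])
      (use e const in \<open>auto intro: has_vector_derivative_const\<close>)
  ultimately have "blinfun_apply B v = 0"
    by (rule vector_derivative_unique_at)
  moreover have "v \<in> tangent_space M x"
    unfolding tangent_space_def using e C1 sub at0 der by (auto simp: constraint_set_def)
  ultimately show "v \<in> tangent_space M x \<inter> {v. blinfun_apply B v = 0}"
    by blast
qed

lemma zero_in_tangent_space: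
  assumes "x \<in> N"
  shows "0 \<in> tangent_space N x"
proof -
  have "(\<lambda>_::real. x) ` {-1<..<1} \<subseteq> N"
    using assms by auto
  moreover have "((\<lambda>_. x) has_vector_derivative 0) (at (0::real))"
    by (rule has_vector_derivative_const)
  moreover have "(\<lambda>_. x) C1_differentiable_on {-1<..<1::real}"
    by simp
  ultimately show ?thesis
    unfolding tangent_space_def
    by (intro CollectI exI[of _ "\<lambda>_. x"] exI[of _ "1::real"]) auto
qed

section \<open>The implicit function\<close>

theorem theorem5p1:
  fixes M X :: "'e::{real_inner,complete_space} set"
    and B :: "'e \<Rightarrow>\<^sub>L 'y::{real_inner,complete_space}"
    and c :: 'y
    and P :: "'e \<Rightarrow> 'e \<Rightarrow>\<^sub>L 'e"
    and R :: "'e \<Rightarrow> 'e \<Rightarrow> 'e"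
    and DR :: "'e \<Rightarrow> 'e \<Rightarrow> 'e \<Rightarrow>\<^sub>L 'e"
    and D2R :: "'e \<Rightarrow> 'e \<Rightarrow> 'e \<Rightarrow>\<^sub>L 'e \<Rightarrow>\<^sub>L 'e"
  assumes M: "C2_embedded_submanifold M"
    and B_surj: "surj (blinfun_apply B)"
    and nonempty: "constraint_set M B c \<noteq> {}"
    and P_proj: "\<And>x. x \<in> M \<Longrightarrow> P x o\<^sub>L P x = P x"
    and P_range: "\<And>x. x \<in> M \<Longrightarrow> range (blinfun_apply (P x)) = tangent_space M x"
    and R_into: "\<And>x u. x \<in> M \<Longrightarrow> u \<in> tangent_space M x \<Longrightarrow> R x u \<in> M"
    and R_C2: "\<And>x. x \<in> M \<Longrightarrow> C2_derivs_on (tangent_space M x) (R x) (DR x) (D2R x)"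
    and R_0: "\<And>x. x \<in> M \<Longrightarrow> R x 0 = x"
    and DR_0: "\<And>x h. x \<in> M \<Longrightarrow> h \<in> tangent_space M x \<Longrightarrow> blinfun_apply (DR x 0) h = h"
    and A1: "\<And>S. S \<subseteq> constraint_set M B c \<Longrightarrow> bounded S \<Longrightarrow>
               \<exists>C>0. \<forall>x\<in>S. \<forall>\<delta>. L_op B P x \<delta> \<bullet> \<delta> \<ge> C * (norm \<delta>)\<^sup>2"
    and A2_cont: "continuous_on M P"
    and A2_bdd: "\<And>S. S \<subseteq> M \<Longrightarrow> bounded S \<Longrightarrow> bounded (P ` S)"
    and A3: "\<And>S. S \<subseteq> M \<Longrightarrow> bounded S \<Longrightarrow>
               \<exists>\<sigma>>0. \<exists>K1>0. \<exists>K2>0. \<forall>x\<in>S. \<forall>u\<in>tangent_space M x. norm u \<le> \<sigma> \<longrightarrow>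
                 (\<forall>h\<in>tangent_space M x. norm (blinfun_apply (DR x u) h) \<le> K1 * norm h) \<and>
                 (\<forall>h\<in>tangent_space M x. \<forall>k\<in>tangent_space M x.
                    norm (blinfun_apply (blinfun_apply (D2R x u) h) k) \<le> K2 * norm h * norm k)"
    and X: "X \<subseteq> constraint_set M B c" "bounded X"
  shows "\<exists>\<Delta>>0. \<exists>r>0. \<forall>x\<in>X.
           \<exists>\<delta>. implicit_solution M B c P R x \<Delta> r \<delta> \<and> \<delta> 0 = 0 \<and>
             (\<forall>\<delta>'. implicit_solution M B c P R x \<Delta> r \<delta>' \<longrightarrow>
                (\<forall>v \<in> tangent_ball (constraint_set M B c) x \<Delta>. \<delta>' v = \<delta> v))"
proof -
  let ?A = "adjoint (blinfun_apply B)"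
  let ?V = "\<lambda>x \<rho>. tangent_ball (constraint_set M B c) x \<rho>"
  have XM: "X \<subseteq> M" and BX: "\<And>x. x \<in> X \<Longrightarrow> blinfun_apply B x = c"
    using X(1) by (auto simp: constraint_set_def)
  obtain C where C: "0 < C" and coercive: "\<And>x a. x \<in> X \<Longrightarrow> C * (norm a)\<^sup>2 \<le> L_op B P x a \<bullet> a"
    using A1[OF X] by blast
  obtain \<sigma> K where \<sigma>: "0 < \<sigma>" and K: "0 < K"
    and D2: "\<And>x u h k. x \<in> X \<Longrightarrow> u \<in> tangent_space M x \<Longrightarrow> norm u \<le> \<sigma> \<Longrightarrow>
               h \<in> tangent_space M x \<Longrightarrow> k \<in> tangent_space M x \<Longrightarrow>
               norm (blinfun_apply (blinfun_apply (D2R x u) h) k) \<le> K * norm h * norm k"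
    using A3[OF XM X(2)] by metis
  obtain p where p: "0 < p" and Pp: "\<And>x. x \<in> X \<Longrightarrow> norm (P x) \<le> p"
    using A2_bdd[OF XM X(2)] unfolding bounded_pos by auto
  define b where "b = norm B + 1"
  have b: "0 < b" "norm B \<le> b"
    by (simp_all add: b_def add_nonneg_pos)
  have B_le: "norm (blinfun_apply B u) \<le> b * k" if "norm u \<le> k" for u k
    by (rule order_trans[OF norm_blinfun]) (use that b in \<open>intro mult_mono, auto\<close>)
  have A_le: "norm (?A a) \<le> b * norm a" for a
    by (meson b(2) mult_right_mono norm_adjoint_hilbert_le norm_ge_zero order_trans)
  have PA_le: "norm (blinfun_apply (P x) (?A a)) \<le> p * b * norm a" if "x \<in> X" for x a
  proof -
    have "norm (blinfun_apply (P x) (?A a)) \<le> norm (P x) * norm (?A a)"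
      by (rule norm_blinfun)
    also have "\<dots> \<le> p * (b * norm a)"
      using Pp[OF that] A_le p by (intro mult_mono) auto
    finally show ?thesis
      by (simp add: mult_ac)
  qed
  \<comment> \<open>The monotonicity lost to the retraction error is \<open>b * (K * \<rho>) * (p * b)\<close>, so this \<open>\<rho>\<close> keeps it
      below \<open>C / 2\<close>.  The radii \<open>r\<close> and \<open>\<Delta>\<close> keep \<open>v - P x (?A a)\<close> in the \<open>\<rho>\<close>-ball, and the second
      bound on \<open>\<Delta>\<close> makes the value at \<open>a = 0\<close> small enough.\<close>
  define \<rho> where "\<rho> = min \<sigma> (C / (2 * b\<^sup>2 * p * K))"
  define r where "r = \<rho> / (2 * p * b)"
  define \<Delta> where "\<Delta> = min (\<rho> / 2) (C * r / (4 * b * K * \<rho>))"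
  have \<rho>: "0 < \<rho>" "\<rho> \<le> \<sigma>"
    using \<sigma> C b p K by (auto simp: \<rho>_def)
  have r: "0 < r"
    using \<rho> p b by (simp add: r_def)
  have \<Delta>: "0 < \<Delta>"
    using \<rho> r C b K by (simp add: \<Delta>_def)
  have loss: "b * (K * \<rho>) * (p * b) \<le> C / 2"
  proof -
    have "\<rho> \<le> C / (2 * b\<^sup>2 * p * K)"
      by (simp add: \<rho>_def)
    then show ?thesis
      using b p K by (simp add: field_simps power2_eq_square)
  qed
  have "\<exists>\<delta>. implicit_solution M B c P R x \<Delta> r \<delta> \<and> \<delta> 0 = 0 \<and>
          (\<forall>\<delta>'. implicit_solution M B c P R x \<Delta> r \<delta>' \<longrightarrow> (\<forall>v \<in> ?V x \<Delta>. \<delta>' v = \<delta> v))"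
    if x: "x \<in> X" for x
  proof -
    let ?T = "tangent_space M x"
    have xM: "x \<in> M"
      using x XM by blast
    have T: "subspace ?T"
      unfolding P_range[OF xM, symmetric]
      by (intro linear_subspace_image bounded_linear.linear blinfun.bounded_linear_right subspace_UNIV)
    have PT: "blinfun_apply (P x) u \<in> ?T" for u
      using P_range[OF xM] by auto
    have V: "v \<in> ?T" "blinfun_apply B v = 0" "norm v < \<Delta>" if "v \<in> ?V x \<Delta>" for v
      using that tangent_space_constraint_set_subset[of M B c x] by (auto simp: tangent_ball_def)
    define E where "E u = R x u - u" for u
    have E_lip: "norm (E w - E u) \<le> K * \<rho> * norm (w - u)"
      if "u \<in> ?T" "norm u \<le> \<rho>" "w \<in> ?T" "norm w \<le> \<rho>" for u w
      unfolding E_def using that K D2[OF x] \<rho>(2)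
      by (intro retraction_error_lipschitz[OF T R_C2[OF xM] DR_0[OF xM]]) auto
    define U where "U v a = v - blinfun_apply (P x) (?A a)" for v a
    define G where "G v a = c - F_map B P R x v a" for v a
    have U_T: "U v a \<in> ?T" if "v \<in> ?V x \<Delta>" for v a
      using V(1)[OF that] PT T by (simp add: U_def subspace_diff)
    have U_small: "norm (U v a) \<le> \<rho>" if v: "v \<in> ?V x \<Delta>" and a: "a \<in> cball 0 r" for v a
    proof -
      have "norm (U v a) \<le> norm v + norm (blinfun_apply (P x) (?A a))"
        unfolding U_def by (rule norm_triangle_ineq4)
      moreover have "norm v \<le> \<rho> / 2"
        using V(3)[OF v] by (simp add: \<Delta>_def)
      moreover have "p * b * norm a \<le> p * b * r"
        using a p b by (intro mult_left_mono) auto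
      moreover have "p * b * r = \<rho> / 2"
        using p b by (simp add: r_def)
      ultimately show ?thesis
        using PA_le[OF x, of a] by linarith
    qed
    have U_diff: "U v a - U v a' = - blinfun_apply (P x) (?A (a - a'))" for v a a'
      by (simp add: U_def adjoint_diff_hilbert blinfun.diff_right)
    have G_diff: "G v a - G v a' = L_op B P x (a - a') - blinfun_apply B (E (U v a) - E (U v a'))"
      for v a a'
    proof -
      have "G v a - G v a' = - blinfun_apply B (R x (U v a) - R x (U v a'))"
        by (simp add: G_def F_map_def U_def blinfun.diff_right)
      also have "R x (U v a) - R x (U v a') = (U v a - U v a') + (E (U v a) - E (U v a'))"
        by (simp add: E_def)
      finally show ?thesis
        unfolding U_diff by (simp add: L_op_def blinfun.diff_right blinfun.add_right blinfun.minus_right)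
    qed
    have error: "norm (blinfun_apply B (E (U v a) - E (U v a'))) \<le> C / 2 * norm (a - a')"
      if v: "v \<in> ?V x \<Delta>" and a: "a \<in> cball 0 r" "a' \<in> cball 0 r" for v a a'
    proof -
      have "norm (E (U v a) - E (U v a')) \<le> K * \<rho> * norm (U v a - U v a')"
        using E_lip U_T U_small v a by blast
      also have "\<dots> \<le> K * \<rho> * (p * b * norm (a - a'))"
        unfolding U_diff norm_minus_cancel using PA_le[OF x] K \<rho> by (intro mult_left_mono) auto
      finally have "norm (blinfun_apply B (E (U v a) - E (U v a'))) \<le>
          b * (K * \<rho> * (p * b * norm (a - a')))"
        by (rule B_le)
      also have "\<dots> = b * (K * \<rho>) * (p * b) * norm (a - a')"
        by simp
      also have "\<dots> \<le> C / 2 * norm (a - a')"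
        using loss by (intro mult_right_mono) auto
      finally show ?thesis .
    qed
    have mono: "C / 2 * (norm (a - a'))\<^sup>2 \<le> (G v a - G v a') \<bullet> (a - a')"
      if v: "v \<in> ?V x \<Delta>" and a: "a \<in> cball 0 r" "a' \<in> cball 0 r" for v a a'
    proof -
      let ?e = "blinfun_apply B (E (U v a) - E (U v a'))"
      have "?e \<bullet> (a - a') \<le> norm ?e * norm (a - a')"
        by (rule norm_cauchy_schwarz)
      also have "\<dots> \<le> C / 2 * norm (a - a') * norm (a - a')"
        using error[OF that] by (intro mult_right_mono) auto
      finally have "?e \<bullet> (a - a') \<le> C / 2 * (norm (a - a'))\<^sup>2"
        by (simp add: power2_eq_square)
      then show ?thesis
        using coercive[OF x, of "a - a'"] unfolding G_diff inner_diff_left[of _ ?e] by linarith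
    qed
    have lip: "norm (G v a - G v a') \<le> (b * (p * b) + C / 2) * norm (a - a')"
      if v: "v \<in> ?V x \<Delta>" and a: "a \<in> cball 0 r" "a' \<in> cball 0 r" for v a a'
    proof -
      have "norm (L_op B P x (a - a')) \<le> b * (p * b * norm (a - a'))"
        unfolding L_op_def by (rule B_le[OF PA_le[OF x]])
      with error[OF that] show ?thesis
        unfolding G_diff using norm_triangle_ineq4[of "L_op B P x (a - a')"
            "blinfun_apply B (E (U v a) - E (U v a'))"]
        by (simp add: algebra_simps)
    qed
    have A0: "?A 0 = 0"
      using adjoint_diff_hilbert[of B 0 0] by simp
    have small: "norm (G v 0) \<le> C / 2 * r / 2" if v: "v \<in> ?V x \<Delta>" for v
    proof -
      \<comment> \<open>Here \<open>B v = 0\<close> removes the first-order term of \<open>R x v - x\<close>.\<close>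
      have "G v 0 = - blinfun_apply B (E v - E 0)"
        using BX[OF x] V(2)[OF v]
        by (simp add: G_def F_map_def E_def A0 R_0[OF xM] blinfun.diff_right)
      moreover have "norm (E v - E 0) \<le> K * \<rho> * norm (v - 0)"
        using V[OF v] \<rho> by (intro E_lip) (auto simp: subspace_0[OF T] \<Delta>_def)
      moreover have "K * \<rho> * norm v \<le> K * \<rho> * \<Delta>"
        using V(3)[OF v] K \<rho> by (intro mult_left_mono) auto
      ultimately have "norm (G v 0) \<le> b * (K * \<rho> * \<Delta>)"
        using B_le[of "E v - E 0" "K * \<rho> * \<Delta>"] by simp
      also have "\<dots> \<le> b * (K * \<rho> * (C * r / (4 * b * K * \<rho>)))"
        using b K \<rho> by (intro mult_left_mono) (auto simp: \<Delta>_def)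
      also have "\<dots> = C / 2 * r / 2"
        using b K \<rho> by (simp add: field_simps)
      finally show ?thesis .
    qed
    have cont: "continuous_on (?V x \<Delta>) (\<lambda>v. G v a)" for a
    proof -
      have "continuous_on ?T (R x)"
        using R_C2[OF xM] unfolding C2_derivs_on_def by (intro has_derivative_continuous_on) blast
      then have "continuous_on (?V x \<Delta>) (\<lambda>v. R x (U v a))"
      proof (rule continuous_on_compose2)
        show "continuous_on (?V x \<Delta>) (\<lambda>v. U v a)"
          unfolding U_def by (intro continuous_intros)
      qed (use U_T in auto)
      then show ?thesis
        unfolding G_def F_map_def U_def by (intro continuous_intros)
    qed
    have "0 < C / 2" "0 \<le> r"
      using C r by simp_all
    from strongly_monotone_implicit_function[where V = "?V x \<Delta>", OF this mono lip small cont]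
    obtain \<delta> where \<delta>: "continuous_on (?V x \<Delta>) \<delta>"
      "\<And>v. v \<in> ?V x \<Delta> \<Longrightarrow> \<delta> v \<in> cball 0 r \<and> G v (\<delta> v) = 0"
      and unique: "\<And>v a. v \<in> ?V x \<Delta> \<Longrightarrow> a \<in> cball 0 r \<Longrightarrow> G v a = 0 \<Longrightarrow> a = \<delta> v"
      by blast
    have "implicit_solution M B c P R x \<Delta> r \<delta>"
      using \<delta> unfolding implicit_solution_def G_def by fastforce
    moreover have "\<delta> 0 = 0"
    proof -
      have "0 \<in> ?V x \<Delta>"
        using zero_in_tangent_space[of x] x X(1) \<Delta> by (auto simp: tangent_ball_def)
      moreover have "G 0 0 = 0"
        using BX[OF x] by (simp add: G_def F_map_def A0 R_0[OF xM])
      ultimately show ?thesis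
        using unique[of 0 0] r by simp
    qed
    moreover have "\<delta>' v = \<delta> v" if "implicit_solution M B c P R x \<Delta> r \<delta>'" "v \<in> ?V x \<Delta>" for \<delta>' v
      using that by (intro unique) (auto simp: implicit_solution_def G_def)
    ultimately show ?thesis
      by blast
  qed
  with \<Delta> r show ?thesis
    by blast
qed

end
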